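(* Let $\alpha\in(0,1)$ and $p,q,c,\delta,E_M,r>0$. Consider the optimal control problem $$\max_{E(\cdot),\,\lambda(\cdot)}\ \int_0^\infty e^{-\delta t}\Big(pq\frac{x_2(t)}{1-\alpha}-c\Big)E(t)\,dt$$ subject to $$\dot x_1=r x_1(1-(x_1+x_2))+\lambda\Big(\frac{x_2}{1-\alpha}-\frac{x_1}{\alpha}\Big),$$ $$\dot x_2=r x_2(1-(x_1+x_2))-\lambda\Big(\frac{x_2}{1-\alpha}-\frac{x_1}{\alpha}\Big)-qE\frac{x_2}{1-\alpha},$$ $$0\le E(t)\le E_M .$$ This problem possesses at most one non-trivial and positive stationary solution (stationary solution of its first-order optimality conditions), given by $$(x_1^*,x_2^* )=\Big(1-\frac{c(1-\alpha)}{pq},\ \frac{c(1-\alpha)}{pq}\Big).$$ The corresponding effort, diffusion coefficient and total revenue are null: $E^*=0$, $\lambda^*=0$ (the latter when $pq\neq c$), and the value of the objective is $0$.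
   Context: Let $\phi(z)=rz(1-z)$. Summing the dynamics gives $E=\frac{1-\alpha}{q x_2}\big(\phi(x_1+x_2)-\dot x_1-\dot x_2\big)$, so the problem is rewritten as the calculus of variations problem of maximising $$\int_0^\infty e^{-\delta t}\Big(p-\frac{c(1-\alpha)}{q x_2}\Big)\big[\phi(x_1+x_2)-\dot x_1-\dot x_2\big]dt$$ over curves with $x_i$ bounded, $C^1$ and with bounded derivative on $[0,\infty)$, $x_i(0)$ given, and $$\phi(x_1+x_2)-qE_M\frac{x_2}{1-\alpha}\le\dot x_1+\dot x_2\le\phi(x_1+x_2).$$ Its first-order optimality conditions are the Euler–Lagrange equations $$\dot x_1=x_2\Big(\frac{pq\,x_2}{c(1-\alpha)}-1\Big)\big(r-2r(x_1+x_2)-\delta\big)+r(x_1+x_2)(1-(x_1+x_2)),$$ $$\dot x_2=x_2\Big(\frac{pq\,x_2}{c(1-\alpha)}-1\Big)\big(\delta-r+2r(x_1+x_2)\big).$$ A stationary solution is a constant solution $(x_1^*,x_2^* )$ of these equations. It is positive if $x_1^*>0$ and $x_2^*>0$, and non-trivial if it is not $(0,0)$. The corresponding effort $E^*$ and diffusion coefficient $\lambda^*$ are the constants for which $(x_1^*,x_2^* )$ is an equilibrium of the controlled dynamics, and the corresponding total revenue is the value of the objective along this constant trajectory. *)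

theory Defs
  imports "HOL-Analysis.Analysis"
begin

definition growth :: "real \<Rightarrow> real \<Rightarrow> real" where
  "growth r z = r * z * (1 - z)"

definition controlled_dynamics ::
  "real \<Rightarrow> real \<Rightarrow> real \<Rightarrow> (real \<Rightarrow> real) \<Rightarrow> (real \<Rightarrow> real) \<Rightarrow> (real \<Rightarrow> real) \<Rightarrow> (real \<Rightarrow> real) \<Rightarrow> bool"
where
  "controlled_dynamics \<alpha> q r x1 x2 E lam \<longleftrightarrow>
     (\<forall>t\<ge>0.
       (x1 has_real_derivative
          r * x1 t * (1 - (x1 t + x2 t)) + lam t * (x2 t / (1 - \<alpha>) - x1 t / \<alpha>))
         (at t within {0..}) \<and>
       (x2 has_real_derivative
          r * x2 t * (1 - (x1 t + x2 t)) - lam t * (x2 t / (1 - \<alpha>) - x1 t / \<alpha>)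
            - q * E t * (x2 t / (1 - \<alpha>)))
         (at t within {0..}))"

definition admissible ::
  "real \<Rightarrow> real \<Rightarrow> real \<Rightarrow> real \<Rightarrow> (real \<Rightarrow> real) \<Rightarrow> (real \<Rightarrow> real) \<Rightarrow> (real \<Rightarrow> real) \<Rightarrow> (real \<Rightarrow> real) \<Rightarrow> bool"
where
  "admissible \<alpha> q r E_M x1 x2 E lam \<longleftrightarrow>
     controlled_dynamics \<alpha> q r x1 x2 E lam \<and> (\<forall>t\<ge>0. 0 \<le> E t \<and> E t \<le> E_M)"

definition discounted_revenue ::
  "real \<Rightarrow> real \<Rightarrow> real \<Rightarrow> real \<Rightarrow> real \<Rightarrow> (real \<Rightarrow> real) \<Rightarrow> (real \<Rightarrow> real) \<Rightarrow> real \<Rightarrow> real"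
where
  "discounted_revenue \<alpha> p q c \<delta> x2 E t =
     exp (- \<delta> * t) * ((p * q * (x2 t / (1 - \<alpha>)) - c) * E t)"

definition total_revenue ::
  "real \<Rightarrow> real \<Rightarrow> real \<Rightarrow> real \<Rightarrow> real \<Rightarrow> (real \<Rightarrow> real) \<Rightarrow> (real \<Rightarrow> real) \<Rightarrow> real"
where
  "total_revenue \<alpha> p q c \<delta> x2 E =
     (LINT t:{0..}|lborel. discounted_revenue \<alpha> p q c \<delta> x2 E t)"

text \<open>
  The Euler--Lagrange equations of the reduced problem (effort eliminated through the summed
  dynamics), solved for the velocities. For curves with \<open>x2 > 0\<close> they are equivalent to the
  equations obtained from the Lagrangian: see \<open>euler_lagrange_iff_optimality_system\<close> below.
\<close>

definition optimality_system ::
  "real \<Rightarrow> real \<Rightarrow> real \<Rightarrow> real \<Rightarrow> real \<Rightarrow> real \<Rightarrow> (real \<Rightarrow> real) \<Rightarrow> (real \<Rightarrow> real) \<Rightarrow> bool"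
where
  "optimality_system \<alpha> p q c \<delta> r x1 x2 \<longleftrightarrow>
     (\<forall>t\<ge>0.
       (x1 has_real_derivative
          x2 t * (p * q * x2 t / (c * (1 - \<alpha>)) - 1) * (r - 2 * r * (x1 t + x2 t) - \<delta>)
            + r * (x1 t + x2 t) * (1 - (x1 t + x2 t)))
         (at t within {0..}) \<and>
       (x2 has_real_derivative
          x2 t * (p * q * x2 t / (c * (1 - \<alpha>)) - 1) * (\<delta> - r + 2 * r * (x1 t + x2 t)))
         (at t within {0..}))"

definition stationary_solution ::
  "real \<Rightarrow> real \<Rightarrow> real \<Rightarrow> real \<Rightarrow> real \<Rightarrow> real \<Rightarrow> real \<times> real \<Rightarrow> bool"
where
  "stationary_solution \<alpha> p q c \<delta> r x \<longleftrightarrow>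
     optimality_system \<alpha> p q c \<delta> r (\<lambda>t. fst x) (\<lambda>t. snd x)"

definition positive_state :: "real \<times> real \<Rightarrow> bool" where
  "positive_state x \<longleftrightarrow> fst x > 0 \<and> snd x > 0"

definition nontrivial_state :: "real \<times> real \<Rightarrow> bool" where
  "nontrivial_state x \<longleftrightarrow> x \<noteq> (0, 0)"

definition controlled_equilibrium ::
  "real \<Rightarrow> real \<Rightarrow> real \<Rightarrow> real \<times> real \<Rightarrow> real \<Rightarrow> real \<Rightarrow> bool"
where
  "controlled_equilibrium \<alpha> q r x E lam \<longleftrightarrow>
     controlled_dynamics \<alpha> q r (\<lambda>t. fst x) (\<lambda>t. snd x) (\<lambda>t. E) (\<lambda>t. lam)"

definition stationary_candidate :: "real \<Rightarrow> real \<Rightarrow> real \<Rightarrow> real \<Rightarrow> real \<times> real" where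
  "stationary_candidate \<alpha> p q c =
     (1 - c * (1 - \<alpha>) / (p * q), c * (1 - \<alpha>) / (p * q))"

definition reduced_lagrangian ::
  "real \<Rightarrow> real \<Rightarrow> real \<Rightarrow> real \<Rightarrow> real \<Rightarrow> real \<Rightarrow> real \<Rightarrow> real \<Rightarrow> real \<Rightarrow> real \<Rightarrow> real \<Rightarrow> real"
where
  "reduced_lagrangian \<alpha> p q c \<delta> r t y1 y2 v1 v2 =
     exp (- \<delta> * t) * (p - c * (1 - \<alpha>) / (q * y2)) * (growth r (y1 + y2) - v1 - v2)"

definition euler_lagrange ::
  "(real \<Rightarrow> real \<Rightarrow> real \<Rightarrow> real \<Rightarrow> real \<Rightarrow> real) \<Rightarrow> (real \<Rightarrow> real) \<Rightarrow> (real \<Rightarrow> real) \<Rightarrow> bool"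
where
  "euler_lagrange L x1 x2 \<longleftrightarrow>
     (\<exists>v1 v2. \<forall>t\<ge>0.
       (x1 has_real_derivative v1 t) (at t within {0..}) \<and>
       (x2 has_real_derivative v2 t) (at t within {0..}) \<and>
       ((\<lambda>s. deriv (\<lambda>w. L s (x1 s) (x2 s) w (v2 s)) (v1 s))
          has_real_derivative deriv (\<lambda>y. L t y (x2 t) (v1 t) (v2 t)) (x1 t)) (at t within {0..}) \<and>
       ((\<lambda>s. deriv (\<lambda>w. L s (x1 s) (x2 s) (v1 s) w) (v2 s))
          has_real_derivative deriv (\<lambda>y. L t (x1 t) y (v1 t) (v2 t)) (x2 t)) (at t within {0..}))"

lemma discounted_revenue_eq_reduced_lagrangian:
  assumes "0 < \<alpha>" "\<alpha> < 1" "q > 0" "x2 t \<noteq> 0"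
    and "v1 = r * x1 t * (1 - (x1 t + x2 t)) + lam t * (x2 t / (1 - \<alpha>) - x1 t / \<alpha>)"
    and "v2 = r * x2 t * (1 - (x1 t + x2 t)) - lam t * (x2 t / (1 - \<alpha>) - x1 t / \<alpha>)
                - q * E t * (x2 t / (1 - \<alpha>))"
  shows "discounted_revenue \<alpha> p q c \<delta> x2 E t =
           reduced_lagrangian \<alpha> p q c \<delta> r t (x1 t) (x2 t) v1 v2"
proof -
  have "growth r (x1 t + x2 t) - v1 - v2 = q * E t * (x2 t / (1 - \<alpha>))"
    unfolding growth_def assms(5,6) by (simp add: algebra_simps)
  moreover have "(p - c * (1 - \<alpha>) / (q * x2 t)) * (q * E t * (x2 t / (1 - \<alpha>)))
                   = (p * q * (x2 t / (1 - \<alpha>)) - c) * E t"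
    using assms(1-4) by (simp add: field_simps)
  ultimately show ?thesis
    unfolding discounted_revenue_def reduced_lagrangian_def by (simp only: mult.assoc)
qed

lemma euler_lagrange_iff_optimality_system:
  assumes a: "0 < \<alpha>" "\<alpha> < 1" and pos: "p > 0" "q > 0" "c > 0" and x2: "\<And>t. t \<ge> 0 \<Longrightarrow> x2 t > 0"
  shows "euler_lagrange (reduced_lagrangian \<alpha> p q c \<delta> r) x1 x2 \<longleftrightarrow>
           optimality_system \<alpha> p q c \<delta> r x1 x2"
proof -
  define k where "k = c * (1 - \<alpha>) / q"
  define g where "g = (\<lambda>y. p - c * (1 - \<alpha>) / (q * y))"
  have k: "k > 0" using a pos by (simp add: k_def)
  have g: "g y = p - k / y" for y by (simp add: g_def k_def)
  have pqc: "p * q * y / (c * (1 - \<alpha>)) = p * y / k" for y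
    using a pos by (simp add: k_def field_simps)
  let ?L = "reduced_lagrangian \<alpha> p q c \<delta> r"
  have dv1: "deriv (\<lambda>w. ?L s y1 y2 w v2) v1 = - exp (- \<delta> * s) * g y2" for s y1 y2 v1 v2
    unfolding reduced_lagrangian_def g_def
    by (rule DERIV_imp_deriv) (auto intro!: derivative_eq_intros)
  have dv2: "deriv (\<lambda>w. ?L s y1 y2 v1 w) v2 = - exp (- \<delta> * s) * g y2" for s y1 y2 v1 v2
    unfolding reduced_lagrangian_def g_def
    by (rule DERIV_imp_deriv) (auto intro!: derivative_eq_intros)
  have dy1: "deriv (\<lambda>y. ?L s y y2 v1 v2) y1 = exp (- \<delta> * s) * g y2 * (r - 2 * r * (y1 + y2))"
    for s y1 y2 v1 v2
  proof (rule DERIV_imp_deriv)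
    have "((\<lambda>y. growth r (y + y2) - v1 - v2) has_real_derivative (r - 2 * r * (y1 + y2))) (at y1)"
      unfolding growth_def by (auto intro!: derivative_eq_intros simp: algebra_simps)
    then show "((\<lambda>y. ?L s y y2 v1 v2) has_real_derivative
        exp (- \<delta> * s) * g y2 * (r - 2 * r * (y1 + y2))) (at y1)"
      unfolding reduced_lagrangian_def g_def by (rule DERIV_cmult)
  qed
  have dg: "(g has_real_derivative k / y\<^sup>2) (at y)" if "y > 0" for y
    unfolding g using that by (auto intro!: derivative_eq_intros simp: power2_eq_square)
  have dy2: "deriv (\<lambda>y. ?L s y1 y v1 v2) y2 = exp (- \<delta> * s) *
      (k / y2\<^sup>2 * (growth r (y1 + y2) - v1 - v2) + g y2 * (r - 2 * r * (y1 + y2)))"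
    if "y2 > 0" for s y1 y2 v1 v2
  proof (rule DERIV_imp_deriv)
    have gr: "((\<lambda>y. growth r (y1 + y) - v1 - v2) has_real_derivative (r - 2 * r * (y1 + y2))) (at y2)"
      unfolding growth_def by (auto intro!: derivative_eq_intros simp: algebra_simps)
    have "((\<lambda>y. exp (- \<delta> * s) * (g y * (growth r (y1 + y) - v1 - v2))) has_real_derivative
        exp (- \<delta> * s) * (k / y2\<^sup>2 * (growth r (y1 + y2) - v1 - v2)
          + (r - 2 * r * (y1 + y2)) * g y2)) (at y2)"
      by (rule DERIV_cmult[OF DERIV_mult[OF dg[OF that] gr]])
    then show "((\<lambda>y. ?L s y1 y v1 v2) has_real_derivative exp (- \<delta> * s) *
      (k / y2\<^sup>2 * (growth r (y1 + y2) - v1 - v2) + g y2 * (r - 2 * r * (y1 + y2)))) (at y2)"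
      unfolding reduced_lagrangian_def g_def by (simp add: mult.commute mult.left_commute)
  qed
  have dmom: "((\<lambda>s. - exp (- \<delta> * s) * g (x2 s)) has_real_derivative
      exp (- \<delta> * t) * (\<delta> * g (x2 t) - k / (x2 t)\<^sup>2 * v)) (at t within {0..})"
    if t: "t \<ge> 0" and d: "(x2 has_real_derivative v) (at t within {0..})" for t v
  proof -
    have "((\<lambda>s. g (x2 s)) has_real_derivative k / (x2 t)\<^sup>2 * v) (at t within {0..})"
      by (rule DERIV_chain2[OF dg[OF x2[OF t]] d])
    then show ?thesis by (auto intro!: derivative_eq_intros simp: algebra_simps)
  qed
  have uniq: "A = B" if "t \<ge> 0" "(f has_real_derivative A) (at t within {0..})"
    "(f has_real_derivative B) (at t within {0..})" for f :: "real \<Rightarrow> real" and A B t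
  proof -
    have ne: "at t within {0..} \<noteq> bot"
    proof -
      have "at t within {t..} \<le> at t within {0..}"
        by (rule at_le) (use that in auto)
      moreover have "at t within {t..} \<noteq> bot"
        by (simp add: at_within_Ici_at_right)
      ultimately show ?thesis by (metis bot.extremum_uniqueI)
    qed
    show ?thesis
      using tendsto_unique[OF ne that(2)[unfolded has_field_derivative_iff]
          that(3)[unfolded has_field_derivative_iff]] .
  qed
  define f where "f = (\<lambda>t. x2 t * (p * x2 t / k - 1) * (\<delta> - r + 2 * r * (x1 t + x2 t)))"
  define h where "h = (\<lambda>t. x2 t * (p * x2 t / k - 1) * (r - 2 * r * (x1 t + x2 t) - \<delta>)
                      + r * (x1 t + x2 t) * (1 - (x1 t + x2 t)))"
  have os: "optimality_system \<alpha> p q c \<delta> r x1 x2 \<longleftrightarrow> (\<forall>t\<ge>0.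
      (x1 has_real_derivative h t) (at t within {0..}) \<and>
      (x2 has_real_derivative f t) (at t within {0..}))"
    unfolding optimality_system_def f_def h_def pqc by simp
  have hf: "h t = growth r (x1 t + x2 t) - f t" for t
    unfolding h_def f_def growth_def by (simp add: algebra_simps)
  have alg1: "\<delta> * g y - k / y\<^sup>2 * v = g y * (r - 2 * r * s) \<longleftrightarrow>
      v = y * (p * y / k - 1) * (\<delta> - r + 2 * r * s)" if "y > 0" for y v s
  proof -
    have "\<delta> * g y - k / y\<^sup>2 * v = g y * (r - 2 * r * s) \<longleftrightarrow>
        k / y\<^sup>2 * v = g y * (\<delta> - r + 2 * r * s)"
      by (auto simp: algebra_simps)
    also have "\<dots> \<longleftrightarrow> v = y\<^sup>2 / k * (g y * (\<delta> - r + 2 * r * s))"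
      using k that by (auto simp: field_simps)
    also have "y\<^sup>2 / k * (g y * (\<delta> - r + 2 * r * s))
        = (y\<^sup>2 / k * g y) * (\<delta> - r + 2 * r * s)" by simp
    also have "y\<^sup>2 / k * g y = y * (p * y / k - 1)"
      unfolding g using k that by (simp add: field_simps power2_eq_square)
    finally show ?thesis .
  qed
  show ?thesis
  proof
    assume "euler_lagrange ?L x1 x2"
    then obtain v1 v2 where EL: "\<forall>t\<ge>0.
       (x1 has_real_derivative v1 t) (at t within {0..}) \<and>
       (x2 has_real_derivative v2 t) (at t within {0..}) \<and>
       ((\<lambda>s. - exp (- \<delta> * s) * g (x2 s)) has_real_derivative
         exp (- \<delta> * t) * g (x2 t) * (r - 2 * r * (x1 t + x2 t))) (at t within {0..}) \<and>
       ((\<lambda>s. - exp (- \<delta> * s) * g (x2 s)) has_real_derivative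
         deriv (\<lambda>y. ?L t (x1 t) y (v1 t) (v2 t)) (x2 t)) (at t within {0..})"
      unfolding euler_lagrange_def dv1 dv2 dy1 by (elim exE) (rule that)
    have D: "(x1 has_real_derivative v1 t) (at t within {0..})"
      "(x2 has_real_derivative v2 t) (at t within {0..})"
      and E1: "((\<lambda>s. - exp (- \<delta> * s) * g (x2 s)) has_real_derivative
         exp (- \<delta> * t) * g (x2 t) * (r - 2 * r * (x1 t + x2 t))) (at t within {0..})"
      and E2: "((\<lambda>s. - exp (- \<delta> * s) * g (x2 s)) has_real_derivative
         exp (- \<delta> * t) * (k / (x2 t)\<^sup>2 * (growth r (x1 t + x2 t) - v1 t - v2 t)
           + g (x2 t) * (r - 2 * r * (x1 t + x2 t)))) (at t within {0..})"
      if "t \<ge> 0" for t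
      using EL[rule_format, OF that] unfolding dy2[OF x2[OF that]] by blast+
    have "v2 t = f t \<and> v1 t = h t" if t: "t \<ge> 0" for t
    proof -
      have "exp (- \<delta> * t) * (\<delta> * g (x2 t) - k / (x2 t)\<^sup>2 * v2 t)
          = exp (- \<delta> * t) * g (x2 t) * (r - 2 * r * (x1 t + x2 t))"
        by (rule uniq[OF t dmom[OF t D(2)[OF t]] E1[OF t]])
      then have "v2 t = f t" using alg1[OF x2[OF t]] unfolding f_def by simp
      moreover have "exp (- \<delta> * t) * g (x2 t) * (r - 2 * r * (x1 t + x2 t))
          = exp (- \<delta> * t) * (k / (x2 t)\<^sup>2 * (growth r (x1 t + x2 t) - v1 t - v2 t)
           + g (x2 t) * (r - 2 * r * (x1 t + x2 t)))"
        by (rule uniq[OF t E1[OF t] E2[OF t]])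
      then have "k / (x2 t)\<^sup>2 * (growth r (x1 t + x2 t) - v1 t - v2 t) = 0" by simp
      then have "growth r (x1 t + x2 t) - v1 t - v2 t = 0"
        using k x2[OF t] by simp
      ultimately show ?thesis by (simp add: hf)
    qed
    with D show "optimality_system \<alpha> p q c \<delta> r x1 x2" unfolding os by simp
  next
    assume "optimality_system \<alpha> p q c \<delta> r x1 x2"
    then have D: "\<And>t. t \<ge> 0 \<Longrightarrow> (x1 has_real_derivative h t) (at t within {0..})"
      "\<And>t. t \<ge> 0 \<Longrightarrow> (x2 has_real_derivative f t) (at t within {0..})"
      unfolding os by auto
    have M: "((\<lambda>s. - exp (- \<delta> * s) * g (x2 s)) has_real_derivative
         exp (- \<delta> * t) * g (x2 t) * (r - 2 * r * (x1 t + x2 t))) (at t within {0..})"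
      if t: "t \<ge> 0" for t
      using dmom[OF t D(2)[OF t]] alg1[OF x2[OF t], of "f t" "x1 t + x2 t"]
      by (simp add: f_def mult.assoc)
    have M2: "((\<lambda>s. - exp (- \<delta> * s) * g (x2 s)) has_real_derivative
          deriv (\<lambda>y. ?L t (x1 t) y (h t) (f t)) (x2 t)) (at t within {0..})"
      if t: "t \<ge> 0" for t
      using M[OF t] unfolding dy2[OF x2[OF t]] by (simp add: hf mult.assoc)
    show "euler_lagrange ?L x1 x2"
      unfolding euler_lagrange_def dv1 dv2 dy1
      by (intro exI[of _ h] exI[of _ f] allI impI conjI) (fact D M M2)+
  qed
qed

end

theory Submission
  imports Defs
begin

text \<open>
  A constant curve solves an autonomous differential system exactly when the right-hand side
  vanishes there, so everything reduces to algebra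
  (\<open>stationary_solution_iff\<close>, \<open>controlled_equilibrium_iff\<close>).

  Write \<open>s = x1 + x2\<close>. In both systems the coupling terms of the two zones cancel in the sum
  of the equations. For the Euler--Lagrange system the sum is \<open>r * s * (1 - s) = 0\<close>, so a positive
  stationary solution has \<open>s = 1\<close>: the total stock sits at its carrying capacity. The second
  equation then becomes \<open>x2 * (p * q * x2 / (c * (1 - \<alpha>)) - 1) * (\<delta> + r) = 0\<close>, and since
  \<open>\<delta> + r > 0\<close> the stock \<open>x2\<close> is the break-even level \<open>c * (1 - \<alpha>) / (p * q)\<close>, where the price of
  the catch pays exactly for the effort.

  At this point growth vanishes, so the sum of the controlled equations leaves no room for a
  harvest: \<open>E = 0\<close>. The only remaining term is the diffusive flux, and the difference of the two
  densities is \<open>(c - p * q) / (\<alpha> * p * q)\<close>; unless it is zero, \<open>\<lambda>\<close> must vanish. The revenue is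
  null because its integrand carries the factor \<open>E\<close>.
\<close>

lemma const_has_derivative_on_halfline_iff:
  "(\<forall>t\<ge>0::real. ((\<lambda>_. a) has_real_derivative d) (at t within {0..})) \<longleftrightarrow> d = 0"
proof
  assume "\<forall>t\<ge>0::real. ((\<lambda>_. a) has_real_derivative d) (at t within {0..})"
  then have "((\<lambda>_. a) has_real_derivative d) (at (1::real) within {0..})" by simp
  \<comment> \<open>At an interior time the derivative relative to the half-line is the ordinary, unique one.\<close>
  moreover have "at (1::real) within {0..} = at 1"
    by (rule at_within_interior) simp
  ultimately have "((\<lambda>_. a) has_real_derivative d) (at (1::real))" by simp
  then show "d = 0" by (rule DERIV_unique) simp
qed simp

lemma stationary_solution_iff:
  "stationary_solution \<alpha> p q c \<delta> r (y1, y2) \<longleftrightarrow>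
     y2 * (p * q * y2 / (c * (1 - \<alpha>)) - 1) * (r - 2 * r * (y1 + y2) - \<delta>)
       + r * (y1 + y2) * (1 - (y1 + y2)) = 0 \<and>
     y2 * (p * q * y2 / (c * (1 - \<alpha>)) - 1) * (\<delta> - r + 2 * r * (y1 + y2)) = 0"
  unfolding stationary_solution_def optimality_system_def fst_conv snd_conv
    imp_conjR all_conj_distrib const_has_derivative_on_halfline_iff ..

lemma controlled_equilibrium_iff:
  "controlled_equilibrium \<alpha> q r (y1, y2) E lam \<longleftrightarrow>
     r * y1 * (1 - (y1 + y2)) + lam * (y2 / (1 - \<alpha>) - y1 / \<alpha>) = 0 \<and>
     r * y2 * (1 - (y1 + y2)) - lam * (y2 / (1 - \<alpha>) - y1 / \<alpha>) - q * E * (y2 / (1 - \<alpha>)) = 0"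
  unfolding controlled_equilibrium_def controlled_dynamics_def fst_conv snd_conv
    imp_conjR all_conj_distrib const_has_derivative_on_halfline_iff ..

text \<open>
  Adding the two equations isolates the total stock and forces it to the carrying capacity; there
  the factor \<open>\<delta> - r + 2 * r * (x1 + x2)\<close> is \<open>\<delta> + r\<close>, which leaves only the break-even level for
  a positive second component.
\<close>

lemma positive_stationary_solution_unique:
  assumes "\<alpha> < 1" "p > 0" "q > 0" "c > 0" "\<delta> > 0" "r > 0"
    and stat: "stationary_solution \<alpha> p q c \<delta> r x" and pos: "positive_state x"
  shows "x = stationary_candidate \<alpha> p q c"
proof -
  obtain y1 y2 where x: "x = (y1, y2)" by (cases x)
  have y: "y1 > 0" "y2 > 0" using pos by (auto simp: x positive_state_def)
  define m where "m = y2 * (p * q * y2 / (c * (1 - \<alpha>)) - 1)"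
  have e1: "m * (r - 2 * r * (y1 + y2) - \<delta>) + r * (y1 + y2) * (1 - (y1 + y2)) = 0"
    and e2: "m * (\<delta> - r + 2 * r * (y1 + y2)) = 0"
    using stat unfolding x stationary_solution_iff m_def by auto
  have "r * (y1 + y2) * (1 - (y1 + y2)) = 0"
    using e1 e2 by (simp add: algebra_simps)
  then have s: "y1 + y2 = 1" using y \<open>r > 0\<close> by auto
  have "m * (\<delta> + r) = 0" using e2 unfolding s by (simp add: algebra_simps)
  then have "m = 0" using \<open>\<delta> > 0\<close> \<open>r > 0\<close> by simp
  then have "p * q * y2 / (c * (1 - \<alpha>)) = 1"
    using y assms(2,3) by (simp add: m_def)
  then have "y2 = c * (1 - \<alpha>) / (p * q)"
    using assms(1-4) by (auto simp: field_simps)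
  then show ?thesis
    using s unfolding x stationary_candidate_def by auto
qed

lemma stationary_candidate_stationary:
  assumes "\<alpha> < 1" "p > 0" "q > 0" "c > 0"
  shows "stationary_solution \<alpha> p q c \<delta> r (stationary_candidate \<alpha> p q c)"
  using assms unfolding stationary_candidate_def stationary_solution_iff by simp

text \<open>
  Growth is zero at the carrying capacity, so in each equation the diffusive flux must balance on
  its own and no harvest can be compensated. If \<open>p * q = c\<close>, both zones have the same density and
  diffusion of any strength leaves the state unchanged.
\<close>

lemma stationary_candidate_equilibrium_iff:
  assumes "0 < \<alpha>" "\<alpha> < 1" "p > 0" "q > 0" "c > 0"
  shows "controlled_equilibrium \<alpha> q r (stationary_candidate \<alpha> p q c) E lam \<longleftrightarrow>
           E = 0 \<and> (p * q \<noteq> c \<longrightarrow> lam = 0)"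
proof -
  define y where "y = c * (1 - \<alpha>) / (p * q)"
  have y: "y > 0" using assms by (simp add: y_def)
  have flux: "y / (1 - \<alpha>) - (1 - y) / \<alpha> = (c - p * q) / (\<alpha> * p * q)"
    using assms by (simp add: y_def field_simps)
  have "controlled_equilibrium \<alpha> q r (stationary_candidate \<alpha> p q c) E lam \<longleftrightarrow>
      lam * ((c - p * q) / (\<alpha> * p * q)) = 0 \<and> q * E * (y / (1 - \<alpha>)) = 0"
    unfolding stationary_candidate_def y_def[symmetric] controlled_equilibrium_iff flux by auto
  then show ?thesis using assms y by auto
qed

lemma discounted_revenue_no_effort:
  "discounted_revenue \<alpha> p q c \<delta> x2 (\<lambda>_. 0) = (\<lambda>_. 0)"
  by (simp add: discounted_revenue_def fun_eq_iff)

theorem proposition2: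
  fixes \<alpha> p q c \<delta> E_M r :: real
  assumes "0 < \<alpha>" "\<alpha> < 1"
    and "p > 0" "q > 0" "c > 0" "\<delta> > 0" "E_M > 0" "r > 0"
  shows "(\<forall>x. stationary_solution \<alpha> p q c \<delta> r x \<and> nontrivial_state x \<and> positive_state x
              \<longrightarrow> x = stationary_candidate \<alpha> p q c)
    \<and> stationary_solution \<alpha> p q c \<delta> r (stationary_candidate \<alpha> p q c)
    \<and> admissible \<alpha> q r E_M
        (\<lambda>t. fst (stationary_candidate \<alpha> p q c)) (\<lambda>t. snd (stationary_candidate \<alpha> p q c))
        (\<lambda>t. 0) (\<lambda>t. 0)
    \<and> (\<forall>E lam. controlled_equilibrium \<alpha> q r (stationary_candidate \<alpha> p q c) E lam \<longrightarrow>
          E = 0 \<and> (p * q \<noteq> c \<longrightarrow> lam = 0)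
          \<and> set_integrable lborel {0..}
              (discounted_revenue \<alpha> p q c \<delta>
                (\<lambda>t. snd (stationary_candidate \<alpha> p q c)) (\<lambda>t. E))
          \<and> total_revenue \<alpha> p q c \<delta>
              (\<lambda>t. snd (stationary_candidate \<alpha> p q c)) (\<lambda>t. E) = 0)"
proof -
  note equilibrium_iff = stationary_candidate_equilibrium_iff[OF assms(1-5)]
  have "controlled_equilibrium \<alpha> q r (stationary_candidate \<alpha> p q c) 0 0"
    unfolding equilibrium_iff by simp
  then have "admissible \<alpha> q r E_M
      (\<lambda>t. fst (stationary_candidate \<alpha> p q c)) (\<lambda>t. snd (stationary_candidate \<alpha> p q c))
      (\<lambda>t. 0) (\<lambda>t. 0)"
    using \<open>E_M > 0\<close> unfolding admissible_def controlled_equilibrium_def by simp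
  moreover have "E = 0 \<and> (p * q \<noteq> c \<longrightarrow> lam = 0)
      \<and> set_integrable lborel {0..} (discounted_revenue \<alpha> p q c \<delta> x2 (\<lambda>t. E))
      \<and> total_revenue \<alpha> p q c \<delta> x2 (\<lambda>t. E) = 0"
    if "controlled_equilibrium \<alpha> q r (stationary_candidate \<alpha> p q c) E lam" for E lam x2
  proof -
    from that have *: "E = 0" "p * q \<noteq> c \<longrightarrow> lam = 0" unfolding equilibrium_iff by auto
    then show ?thesis
      by (simp add: total_revenue_def discounted_revenue_no_effort set_integrable_def)
  qed
  ultimately show ?thesis
    using positive_stationary_solution_unique[OF assms(2-6,8)] stationary_candidate_stationary[OF assms(2-5)]
    by simp
qed

end
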